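(* Let $\Delta$ be the Hodge Laplacian on the flat 1-torus $\mathbb{T}$ and $T_\Delta:=(1+\Delta)^{-1/2}$ on $L^2(\mathbb{T})$. There is a positive function $f\in L^1(\mathbb{T})$ such that the operator $T_\Delta^{1/2}M_fT_\Delta^{1/2}$ is not Hilbert-Schmidt.
   Context: $\mathbb{T}=\mathbb{R}/\mathbb{Z}\cong[-\tfrac12,\tfrac12]$ with endpoints identified, with Lebesgue measure, and $\Delta=-d^2/dx^2$. $M_f$ is the (possibly unbounded) operator of multiplication by $f$ on $L^2(\mathbb{T})$. For $f\ge0$ the operator $T_\Delta^{1/2}M_fT_\Delta^{1/2}$ is understood as $|M_{\sqrt f}T_\Delta^{1/2}|^2$; "not Hilbert-Schmidt" means that it does not define (by closure) a bounded operator in the Hilbert-Schmidt class. *)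

theory Defs
  imports "HOL-Analysis.Analysis"
begin

text \<open>
  Elements of \<open>L\<^sup>2(\<real>/\<int>)\<close> are represented by complex functions on the fundamental domain
  \<open>[-1/2, 1/2]\<close> (values elsewhere are irrelevant, and the identified endpoints form a null set);
  equality in \<open>L\<^sup>2\<close> is equality almost everywhere.  A possibly unbounded operator is given by its
  graph, a set of pairs of representatives.
\<close>

abbreviation torus :: "real measure" where
  "torus \<equiv> lebesgue_on {-1/2..1/2}"

definition L2 :: "(real \<Rightarrow> complex) set" where
  "L2 = {u \<in> borel_measurable torus. integrable torus (\<lambda>x. (norm (u x))\<^sup>2)}"

definition inner2 :: "(real \<Rightarrow> complex) \<Rightarrow> (real \<Rightarrow> complex) \<Rightarrow> complex" where
  "inner2 u v = (LINT x|torus. cnj (u x) * v x)"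

definition norm2 :: "(real \<Rightarrow> complex) \<Rightarrow> real" where
  "norm2 u = sqrt (LINT x|torus. (norm (u x))\<^sup>2)"

type_synonym operator = "((real \<Rightarrow> complex) \<times> (real \<Rightarrow> complex)) set"

definition op_closure :: "operator \<Rightarrow> operator" where
  "op_closure A = {(u, v). u \<in> L2 \<and> v \<in> L2 \<and>
     (\<exists>us vs. (\<forall>n::nat. (us n, vs n) \<in> A) \<and>
        (\<lambda>n. norm2 (\<lambda>x. us n x - u x)) \<longlonglongrightarrow> 0 \<and>
        (\<lambda>n. norm2 (\<lambda>x. vs n x - v x)) \<longlonglongrightarrow> 0)}"

definition op_adjoint :: "operator \<Rightarrow> operator" where
  "op_adjoint A = {(v, w). v \<in> L2 \<and> w \<in> L2 \<and> (\<forall>(u, y) \<in> A. inner2 y v = inner2 u w)}"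

text \<open>\<open>|A|\<^sup>2 = A* A\<close>; the relational composition \<open>O\<close> applies its left argument first.\<close>

definition op_abs_sq :: "operator \<Rightarrow> operator" where
  "op_abs_sq A = A O op_adjoint A"

definition mult_op :: "(real \<Rightarrow> real) \<Rightarrow> operator" where
  "mult_op f = {(u, v). u \<in> L2 \<and> v \<in> L2 \<and> (AE x in torus. v x = of_real (f x) * u x)}"

text \<open>
  Functional calculus \<open>\<phi>(A)\<close> for a self-adjoint operator \<open>A\<close> that has an orthonormal basis of
  eigenvectors: \<open>v = \<phi>(A) u\<close> iff \<open>\<langle>w, v\<rangle> = \<phi>(t) \<langle>w, u\<rangle>\<close> for all \<open>w\<close> with \<open>A w = t w\<close>,
  that is, iff \<open>v\<close> and \<open>\<phi>(t) u\<close> have the same orthogonal projection to the eigenspace of every \<open>t\<close>.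
  The domain is the maximal one, as \<open>v\<close> is only required to lie in \<open>L\<^sup>2\<close>.
\<close>

definition fun_calc :: "(real \<Rightarrow> real) \<Rightarrow> operator \<Rightarrow> operator" where
  "fun_calc \<phi> A = {(u, v). u \<in> L2 \<and> v \<in> L2 \<and>
     (\<forall>t w. (w, \<lambda>x. of_real t * w x) \<in> A \<longrightarrow> inner2 w v = of_real (\<phi> t) * inner2 w u)}"

text \<open>\<open>-d\<^sup>2/dx\<^sup>2\<close> on smooth 1-periodic functions; \<open>d n\<close> is the \<open>n\<close>-th derivative of \<open>u\<close>.\<close>

definition laplacian_smooth :: operator where
  "laplacian_smooth = {(u, v). (\<forall>x. u (x + 1) = u x) \<and>
     (\<exists>d. d 0 = u \<and> (\<forall>n x. (d n has_vector_derivative d (Suc n) x) (at x)) \<and>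
          v = (\<lambda>x. - d 2 x))}"

text \<open>The operator above is essentially self-adjoint; the Laplacian on \<open>L\<^sup>2\<close> is its closure.\<close>

definition laplacian :: operator where
  "laplacian = op_closure laplacian_smooth"

definition T_laplacian :: operator where
  "T_laplacian = fun_calc (\<lambda>t. (1 + t) powr (-1/2)) laplacian"

definition T_laplacian_sqrt :: operator where
  "T_laplacian_sqrt = fun_calc (\<lambda>t. t powr (1/2)) T_laplacian"

definition bounded_operator :: "operator \<Rightarrow> bool" where
  "bounded_operator K \<longleftrightarrow> K \<subseteq> L2 \<times> L2 \<and> Domain K = L2 \<and>
     (\<forall>(u, v) \<in> K. \<forall>(u', v') \<in> K. \<forall>a b :: complex.
        (\<lambda>x. a * u x + b * u' x, \<lambda>x. a * v x + b * v' x) \<in> K) \<and>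
     (\<exists>C. \<forall>(u, v) \<in> K. norm2 v \<le> C * norm2 u)"

definition orthonormal_basis :: "(nat \<Rightarrow> real \<Rightarrow> complex) \<Rightarrow> bool" where
  "orthonormal_basis g \<longleftrightarrow> range g \<subseteq> L2 \<and>
     (\<forall>m n. inner2 (g m) (g n) = (if m = n then 1 else 0)) \<and>
     (\<forall>u \<in> L2. (\<lambda>N. norm2 (\<lambda>x. u x - (\<Sum>n<N. inner2 (g n) u * g n x))) \<longlonglongrightarrow> 0)"

definition hilbert_schmidt :: "operator \<Rightarrow> bool" where
  "hilbert_schmidt K \<longleftrightarrow> bounded_operator K \<and>
     (\<exists>g h. orthonormal_basis g \<and> (\<forall>n. (g n, h n) \<in> K) \<and> summable (\<lambda>n. (norm2 (h n))\<^sup>2))"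

text \<open>
  \<open>T\<^sup>1\<^sup>/\<^sup>2 M\<^sub>f T\<^sup>1\<^sup>/\<^sup>2\<close> for \<open>f \<ge> 0\<close>, understood as \<open>|A|\<^sup>2\<close> where \<open>A\<close> is the product of multiplication
  by \<open>\<surd>f\<close> and \<open>T\<^sup>1\<^sup>/\<^sup>2\<close> on its natural domain.
\<close>

definition sandwiched_mult :: "(real \<Rightarrow> real) \<Rightarrow> operator" where
  "sandwiched_mult f = op_abs_sq (T_laplacian_sqrt O mult_op (\<lambda>x. sqrt (f x)))"

end

theory Submission
  imports Defs
begin

text \<open>
  The Fejer kernels \<open>F\<^sub>N\<close> have integral \<open>1\<close>, but \<open>\<parallel>T\<^sup>1\<^sup>/\<^sup>2 F\<^sub>N\<parallel>\<^sup>2\<close> grows like \<open>log N\<close>.  Take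
  \<open>f = 1 + \<Sum>\<^sub>j 2\<^sup>-\<^sup>j F\<^sub>N\<close> with \<open>N = N\<^sub>j\<close> growing so fast that \<open>\<parallel>T\<^sup>1\<^sup>/\<^sup>2 F\<^sub>N\<parallel>\<^sup>2\<close> is at least of order \<open>4\<^sup>j\<close>.
  For \<open>y = \<surd>f T\<^sup>1\<^sup>/\<^sup>2 u\<close> and \<open>v\<close> the image of \<open>u\<close>, one has \<open>\<parallel>y\<parallel>\<^sup>2 = \<langle>u, v\<rangle>\<close> and
  \<open>\<langle>F\<^sub>N, T\<^sup>1\<^sup>/\<^sup>2 u\<rangle> = \<langle>F\<^sub>N / \<surd>f, y\<rangle>\<close> with \<open>\<parallel>F\<^sub>N / \<surd>f\<parallel>\<^sup>2 \<le> 2\<^sup>j\<close>.  The resulting estimate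
  \<open>\<bar>\<langle>T\<^sup>1\<^sup>/\<^sup>2 F\<^sub>N, u\<rangle>\<bar>\<^sup>2 \<le> 2\<^sup>j \<bar>\<langle>u, v\<rangle>\<bar>\<close> passes to the closure, and it contradicts boundedness when \<open>u\<close>
  is \<open>T\<^sup>1\<^sup>/\<^sup>2\<close> applied to the sum of the characters of frequency \<open>1, \<dots>, N/2\<close>.  The closure is thus not
  even bounded.  Only Fourier coefficients of \<open>T\<^sup>1\<^sup>/\<^sup>2 u\<close> enter, so completeness of the
  Fourier basis plays no role.
\<close>

subsection \<open>The inner product\<close>

lemma L2_D:
  assumes "u \<in> L2"
  shows "u \<in> borel_measurable torus" "integrable torus (\<lambda>x. (norm (u x))\<^sup>2)"
  using assms by (auto simp: L2_def)

lemma integrable_cnj_mult: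
  assumes u: "u \<in> L2" and v: "v \<in> L2"
  shows "integrable torus (\<lambda>x. cnj (u x) * v x)"
proof (rule Bochner_Integration.integrable_bound)
  show "integrable torus (\<lambda>x. (norm (u x))\<^sup>2 + (norm (v x))\<^sup>2)"
    using L2_D(2)[OF u] L2_D(2)[OF v] by (rule Bochner_Integration.integrable_add)
  note [measurable] = L2_D(1)[OF u] L2_D(1)[OF v]
  have "(\<lambda>x. cnj (u x)) \<in> borel_measurable torus"
    by (rule measurable_compose[OF L2_D(1)[OF u]])
      (intro borel_measurable_continuous_onI continuous_intros)
  then show "(\<lambda>x. cnj (u x) * v x) \<in> borel_measurable torus"
    by measurable
  have "norm (u x) * norm (v x) \<le> (norm (u x))\<^sup>2 + (norm (v x))\<^sup>2" for x
  proof -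
    have "2 * (norm (u x) * norm (v x)) \<le> (norm (u x))\<^sup>2 + (norm (v x))\<^sup>2"
      using sum_squares_bound[of "norm (u x)" "norm (v x)"] by (simp add: mult.assoc)
    moreover have "0 \<le> norm (u x) * norm (v x)" by simp
    ultimately show ?thesis by linarith
  qed
  then show "AE x in torus. norm (cnj (u x) * v x) \<le> norm ((norm (u x))\<^sup>2 + (norm (v x))\<^sup>2)"
    by (simp add: norm_mult)
qed

lemma L2_add:
  assumes u: "u \<in> L2" and v: "v \<in> L2"
  shows "(\<lambda>x. u x + v x) \<in> L2"
  unfolding L2_def
proof safe
  show m: "(\<lambda>x. u x + v x) \<in> borel_measurable torus"
    using L2_D(1)[OF u] L2_D(1)[OF v] by (rule borel_measurable_add)
  show "integrable torus (\<lambda>x. (norm (u x + v x))\<^sup>2)"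
  proof (rule Bochner_Integration.integrable_bound)
    show "integrable torus (\<lambda>x. 2 * (norm (u x))\<^sup>2 + 2 * (norm (v x))\<^sup>2)"
      using L2_D(2)[OF u] L2_D(2)[OF v] by (intro Bochner_Integration.integrable_add) auto
    show "(\<lambda>x. (norm (u x + v x))\<^sup>2) \<in> borel_measurable torus"
      using m by measurable
    have "(norm (u x + v x))\<^sup>2 \<le> 2 * (norm (u x))\<^sup>2 + 2 * (norm (v x))\<^sup>2" for x
    proof -
      have "(norm (u x + v x))\<^sup>2 \<le> (norm (u x) + norm (v x))\<^sup>2"
        by (intro power_mono norm_triangle_ineq) auto
      also have "\<dots> \<le> 2 * (norm (u x))\<^sup>2 + 2 * (norm (v x))\<^sup>2"
        using sum_squares_bound[of "norm (u x)" "norm (v x)"] by (simp add: power2_sum)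
      finally show ?thesis .
    qed
    then show "AE x in torus. norm ((norm (u x + v x))\<^sup>2)
        \<le> norm (2 * (norm (u x))\<^sup>2 + 2 * (norm (v x))\<^sup>2)"
      by simp
  qed
qed

lemma L2_scale:
  assumes u: "u \<in> L2"
  shows "(\<lambda>x. a * u x) \<in> L2"
  using L2_D[OF u] by (auto simp: L2_def norm_mult power_mult_distrib)

lemma L2_diff:
  assumes u: "u \<in> L2" and v: "v \<in> L2"
  shows "(\<lambda>x. u x - v x) \<in> L2"
  using L2_add[OF u L2_scale[OF v, of "-1"]] by simp

lemma L2_sum:
  assumes "finite I" "\<And>i. i \<in> I \<Longrightarrow> u i \<in> L2"
  shows "(\<lambda>x. \<Sum>i\<in>I. u i x) \<in> L2"
  using assms
proof (induction I rule: finite_induct)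
  case empty
  show ?case by (simp add: L2_def)
next
  case (insert i I)
  then show ?case using L2_add[of "u i" "\<lambda>x. \<Sum>i\<in>I. u i x"] by simp
qed

lemma L2_continuous:
  assumes "continuous_on UNIV u"
  shows "u \<in> L2"
proof -
  have u: "continuous_on {-1/2..1/2} u"
    using assms continuous_on_subset by blast
  then have "continuous_on {-1/2..1/2} (\<lambda>x. (norm (u x))\<^sup>2)"
    by (intro continuous_intros)
  then have "integrable torus (\<lambda>x. (norm (u x))\<^sup>2)"
    by (rule continuous_imp_integrable_real)
  moreover have "u \<in> borel_measurable torus"
    using u by (rule continuous_imp_measurable_on_sets_lebesgue) simp
  ultimately show ?thesis
    unfolding L2_def by blast
qed

section \<open>Sesquilinearity, the Cauchy-Schwarz inequality and continuity of the inner
  product\<close>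

lemma inner2_add_left:
  assumes "u \<in> L2" "v \<in> L2" "w \<in> L2"
  shows "inner2 (\<lambda>x. u x + v x) w = inner2 u w + inner2 v w"
  unfolding inner2_def
  using integrable_cnj_mult[OF assms(1,3)] integrable_cnj_mult[OF assms(2,3)]
  by (simp add: distrib_right)

lemma inner2_add_right:
  assumes "u \<in> L2" "v \<in> L2" "w \<in> L2"
  shows "inner2 w (\<lambda>x. u x + v x) = inner2 w u + inner2 w v"
  unfolding inner2_def
  using integrable_cnj_mult[OF assms(3,1)] integrable_cnj_mult[OF assms(3,2)]
  by (simp add: distrib_left)

lemma inner2_scale_left: "inner2 (\<lambda>x. a * u x) v = cnj a * inner2 u v"
  by (simp add: inner2_def mult.assoc)

lemma inner2_scale_right: "inner2 u (\<lambda>x. a * v x) = a * inner2 u v"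
  by (simp add: inner2_def mult.left_commute)

lemma inner2_sum_left:
  assumes "finite I" "\<And>i. i \<in> I \<Longrightarrow> u i \<in> L2" "v \<in> L2"
  shows "inner2 (\<lambda>x. \<Sum>i\<in>I. u i x) v = (\<Sum>i\<in>I. inner2 (u i) v)"
  unfolding inner2_def using integrable_cnj_mult[OF assms(2,3)]
  by (simp add: sum_distrib_right Bochner_Integration.integral_sum)

lemma inner2_sum_right:
  assumes "finite I" "\<And>i. i \<in> I \<Longrightarrow> u i \<in> L2" "v \<in> L2"
  shows "inner2 v (\<lambda>x. \<Sum>i\<in>I. u i x) = (\<Sum>i\<in>I. inner2 v (u i))"
  unfolding inner2_def using integrable_cnj_mult[OF assms(3,2)]
  by (simp add: sum_distrib_left Bochner_Integration.integral_sum)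

lemma norm2_nonneg: "norm2 u \<ge> 0"
  by (simp add: norm2_def)

lemma norm2_squared: "(norm2 u)\<^sup>2 = (LINT x|torus. (norm (u x))\<^sup>2)"
  by (simp add: norm2_def)

lemma inner2_self: "inner2 u u = of_real ((norm2 u)\<^sup>2)"
proof -
  have "cnj (u x) * u x = complex_of_real ((norm (u x))\<^sup>2)" for x
    by (metis complex_norm_square mult.commute)
  then show ?thesis
    by (simp only: norm2_squared inner2_def integral_complex_of_real)
qed

lemma inner2_Cauchy_Schwarz:
  assumes u: "u \<in> L2" and v: "v \<in> L2"
  shows "norm (inner2 u v) \<le> norm2 u * norm2 v"
proof -
  let ?I = "LINT x|torus. norm (u x) * norm (v x)"
  have int: "integrable torus (\<lambda>x. norm (u x) * norm (v x))"
    using integrable_norm[OF integrable_cnj_mult[OF u v]] by (simp add: norm_mult)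
  note [measurable] = L2_D(1)[OF u] L2_D(1)[OF v]
  have nn: "?I \<ge> 0" by (intro Bochner_Integration.integral_nonneg) auto
  \<comment> \<open>Cauchy-Schwarz for nonnegative integrals is applied to the pointwise norms;
    integrability of the three integrands turns it back into an inequality between real
    integrals.\<close>
  have "(\<integral>\<^sup>+x. ennreal (norm (u x)) * ennreal (norm (v x)) \<partial>torus)\<^sup>2
     \<le> (\<integral>\<^sup>+x. (ennreal (norm (u x)))\<^sup>2 \<partial>torus) * (\<integral>\<^sup>+x. (ennreal (norm (v x)))\<^sup>2 \<partial>torus)"
    by (intro Cauchy_Schwarz_nn_integral) measurable
  moreover have "(\<integral>\<^sup>+x. ennreal (norm (u x)) * ennreal (norm (v x)) \<partial>torus) = ennreal ?I"
    using nn_integral_eq_integral[OF int] by (simp add: ennreal_mult)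
  moreover have "(\<integral>\<^sup>+x. (ennreal (norm (w x)))\<^sup>2 \<partial>torus) = ennreal ((norm2 w)\<^sup>2)"
    if "w \<in> L2" for w
    using nn_integral_eq_integral[OF L2_D(2)[OF that]] by (simp add: norm2_squared ennreal_power)
  ultimately have "(ennreal ?I)\<^sup>2 \<le> ennreal ((norm2 u)\<^sup>2) * ennreal ((norm2 v)\<^sup>2)"
    using u v by simp
  then have "ennreal (?I\<^sup>2) \<le> ennreal ((norm2 u * norm2 v)\<^sup>2)"
    using nn by (simp add: ennreal_power ennreal_mult power_mult_distrib)
  then have "?I\<^sup>2 \<le> (norm2 u * norm2 v)\<^sup>2"
    by (simp add: ennreal_le_iff)
  then have "?I \<le> norm2 u * norm2 v"
    by (rule power2_le_imp_le) (simp add: norm2_nonneg)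
  moreover have "norm (inner2 u v) \<le> ?I"
    unfolding inner2_def using integral_norm_bound[of torus "\<lambda>x. cnj (u x) * v x"]
    by (simp add: norm_mult)
  ultimately show ?thesis by linarith
qed

lemma tendsto_inner2:
  assumes L2: "\<And>n. us n \<in> L2" "\<And>n. vs n \<in> L2" "u \<in> L2" "v \<in> L2"
    and us: "(\<lambda>n. norm2 (\<lambda>x. us n x - u x)) \<longlonglongrightarrow> 0"
    and vs: "(\<lambda>n. norm2 (\<lambda>x. vs n x - v x)) \<longlonglongrightarrow> 0"
  shows "(\<lambda>n. inner2 (us n) (vs n)) \<longlonglongrightarrow> inner2 u v"
proof -
  let ?a = "\<lambda>n x. us n x - u x" and ?b = "\<lambda>n x. vs n x - v x"
  have ab: "?a n \<in> L2" "?b n \<in> L2" for n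
    using L2 L2_diff by auto
  \<comment> \<open>Both arguments are split into limit plus error; by Cauchy-Schwarz each of the
    three terms containing an error tends to 0.\<close>
  have "inner2 (us n) (vs n) =
      inner2 u v + (inner2 (?a n) (?b n) + inner2 (?a n) v + inner2 u (?b n))" for n
  proof -
    have "inner2 (us n) (vs n) = inner2 (?a n) (vs n) + inner2 u (vs n)"
      using inner2_add_left[OF ab(1) L2(3) L2(2), of n n] by simp
    moreover have "inner2 w (vs n) = inner2 w (?b n) + inner2 w v" if "w \<in> L2" for w
      using inner2_add_right[OF ab(2) L2(4) that, of n] by simp
    ultimately show ?thesis using ab L2 by simp
  qed
  moreover have "(\<lambda>n. inner2 (?a n) (?b n) + inner2 (?a n) v + inner2 u (?b n)) \<longlonglongrightarrow> 0"
  proof (rule Lim_null_comparison)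
    show "\<forall>\<^sub>F n in sequentially. norm (inner2 (?a n) (?b n) + inner2 (?a n) v + inner2 u (?b n))
        \<le> norm2 (?a n) * norm2 (?b n) + norm2 (?a n) * norm2 v + norm2 u * norm2 (?b n)"
      by (intro always_eventually allI norm_triangle_mono inner2_Cauchy_Schwarz ab L2)
    show "(\<lambda>n. norm2 (?a n) * norm2 (?b n) + norm2 (?a n) * norm2 v + norm2 u * norm2 (?b n)) \<longlonglongrightarrow> 0"
      using us vs by (auto intro!: tendsto_eq_intros)
  qed
  ultimately show ?thesis
    using tendsto_add[OF tendsto_const, of _ 0 sequentially "inner2 u v"] by simp
qed

lemma tendsto_inner2_right:
  assumes "\<And>n. vs n \<in> L2" "u \<in> L2" "v \<in> L2" "(\<lambda>n. norm2 (\<lambda>x. vs n x - v x)) \<longlonglongrightarrow> 0"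
  shows "(\<lambda>n. inner2 u (vs n)) \<longlonglongrightarrow> inner2 u v"
  using assms by (intro tendsto_inner2) (auto simp: norm2_def)

lemma tendsto_inner2_left:
  assumes "\<And>n. us n \<in> L2" "u \<in> L2" "v \<in> L2" "(\<lambda>n. norm2 (\<lambda>x. us n x - u x)) \<longlonglongrightarrow> 0"
  shows "(\<lambda>n. inner2 (us n) v) \<longlonglongrightarrow> inner2 u v"
  using assms by (intro tendsto_inner2) (auto simp: norm2_def)

text \<open>This is the source of all boundary terms: they cancel once \<open>f\<close> takes equal
  values at the two identified endpoints.\<close>

lemma integral_torus_FTC:
  fixes f g :: "real \<Rightarrow> complex"
  assumes deriv: "\<And>x. (f has_vector_derivative g x) (at x)" and cont: "continuous_on UNIV g"
  shows "(LINT x|torus. g x) = f (1/2) - f (-1/2)"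
proof -
  have "integrable torus g"
    using cont continuous_on_subset by (intro continuous_imp_integrable_real) blast
  then have "(LINT x|torus. g x) = integral {-1/2..1/2} g"
    by (intro lebesgue_integral_eq_integral) auto
  also have "\<dots> = f (1/2) - f (-1/2)"
    using deriv by (intro integral_unique fundamental_theorem_of_calculus)
      (auto intro: has_vector_derivative_at_within)
  finally show ?thesis .
qed

subsection \<open>Fourier coefficients and the operators\<close>

definition fourier_char :: "int \<Rightarrow> real \<Rightarrow> complex" where
  "fourier_char m x = cis (2 * pi * of_int m * x)"

definition laplace_eigenvalue :: "int \<Rightarrow> real" where
  "laplace_eigenvalue m = (2 * pi * of_int m)\<^sup>2"

definition T_eigenvalue :: "int \<Rightarrow> real" where
  "T_eigenvalue m = (1 + laplace_eigenvalue m) powr (-1/2)"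

lemma fourier_char_0: "fourier_char 0 x = 1"
  by (simp add: fourier_char_def)

lemma cnj_fourier_char_mult: "cnj (fourier_char l x) * fourier_char m x = fourier_char (m - l) x"
  by (simp add: fourier_char_def cis_cnj cis_mult algebra_simps)

lemma fourier_char_has_derivative:
  "(fourier_char m has_vector_derivative (\<i> * of_real (2 * pi * of_int m)) * fourier_char m x) (at x)"
proof -
  have "((\<lambda>x. exp (\<i> * of_real (2 * pi * of_int m) * of_real x)) has_vector_derivative
      (\<i> * of_real (2 * pi * of_int m)) * exp (\<i> * of_real (2 * pi * of_int m) * of_real x)) (at x)"
    by (rule has_vector_derivative_real_field) (auto intro!: derivative_eq_intros)
  then show ?thesis
    by (simp add: fourier_char_def [abs_def] cis_conv_exp mult.assoc)
qed

lemma fourier_char_continuous: "continuous_on UNIV (fourier_char m)"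
  unfolding fourier_char_def [abs_def] by (intro continuous_intros)

lemma fourier_char_in_L2: "fourier_char m \<in> L2"
  by (intro L2_continuous fourier_char_continuous)

lemma fourier_char_half: "fourier_char m (1/2) = fourier_char m (-1/2)"
proof -
  have "fourier_char m (1/2) = fourier_char m (-1/2) * cis (2 * pi * of_int m)"
    by (simp add: fourier_char_def cis_mult algebra_simps del: cis_multiple_2pi)
  then show ?thesis by (simp add: cis_multiple_2pi)
qed

lemma inner2_fourier_char: "inner2 (fourier_char l) (fourier_char m) = (if l = m then 1 else 0)"
proof (cases "l = m")
  case True
  have "measure torus {-1/2..1/2} = 1"
    by (subst measure_restrict_space) auto
  with True show ?thesis
    by (simp add: inner2_def cnj_fourier_char_mult fourier_char_0)
next
  case False
  let ?c = "\<i> * complex_of_real (2 * pi * of_int (m - l))"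
  have "(LINT x|torus. ?c * fourier_char (m - l) x) = 0"
    using integral_torus_FTC[OF fourier_char_has_derivative[of "m - l"]]
    by (simp add: fourier_char_half continuous_on_mult_left fourier_char_continuous)
  moreover have "?c \<noteq> 0" using False by simp
  ultimately show ?thesis
    using False by (simp add: inner2_def cnj_fourier_char_mult del: of_real_mult of_int_diff)
qed

text \<open>Green's identity on the circle: integrating by parts twice moves the Laplacian onto the
  character, and periodicity of \<open>u\<close> and of its derivative removes the boundary
  terms.\<close>

lemma smooth_inner2_fourier_char:
  assumes "(u, v) \<in> laplacian_smooth"
  shows "u \<in> L2" "v \<in> L2"
    "inner2 v (fourier_char m) = of_real (laplace_eigenvalue m) * inner2 u (fourier_char m)"
proof -
  let ?e = "fourier_char m" and ?c = "\<i> * complex_of_real (2 * pi * of_int m)"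
  obtain d where per: "\<And>x. u (x + 1) = u x" and d0: "d 0 = u"
    and d: "\<And>n x. (d n has_vector_derivative d (Suc n) x) (at x)" and v: "v = (\<lambda>x. - d 2 x)"
    using assms by (auto simp: laplacian_smooth_def)
  have cont: "continuous_on UNIV (d n)" for n
    using d has_vector_derivative_continuous by (fastforce simp: continuous_on_eq_continuous_at)
  show u: "u \<in> L2" using L2_continuous[OF cont[of 0]] d0 by simp
  show v2: "v \<in> L2" unfolding v by (intro L2_continuous continuous_on_minus cont)
  \<comment> \<open>Periodicity is given for \<open>u\<close> only; it passes to the derivative by
    differentiating the translate and using uniqueness of derivatives.\<close>
  have d1_per: "d 1 (x + 1) = d 1 x" for x
  proof -
    have "((\<lambda>y. d 0 (y + 1)) has_vector_derivative d 1 (x + 1)) (at x)"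
    proof -
      have "((\<lambda>y::real. y + 1) has_vector_derivative 1) (at x)"
        by (auto intro!: derivative_eq_intros simp: has_vector_derivative_def)
      then show ?thesis
        using vector_diff_chain_at[of "\<lambda>y. y + 1" 1 x "d 0" "d 1 (x + 1)"] d[of 0 "x + 1"]
        by (simp add: o_def)
    qed
    moreover have "(\<lambda>y. d 0 (y + 1)) = d 0" using per d0 by auto
    ultimately show ?thesis
      using d[of 0 x] vector_derivative_unique_at by fastforce
  qed
  have half: "d 0 (1/2) = d 0 (-1/2)" "d 1 (1/2) = d 1 (-1/2)"
    using per[of "-1/2"] d1_per[of "-1/2"] d0 by simp_all
  \<comment> \<open>A Wronskian: in its derivative \<open>?g\<close> the two products of first
    derivatives cancel, so both integrations by parts happen at once.\<close>
  let ?f = "\<lambda>x. cnj (d 1 x) * ?e x - cnj (d 0 x) * (?c * ?e x)"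
  let ?g = "\<lambda>x. cnj (d 2 x) * ?e x - cnj (d 0 x) * (?c * (?c * ?e x))"
  have "(?f has_vector_derivative ?g x) (at x)" for x
  proof -
    have "((\<lambda>x. cnj (d n x)) has_vector_derivative cnj (d (Suc n) x)) (at x)" for n
      using d by (rule has_vector_derivative_cnj)
    note 1 = this[of 0] this[of 1]
    have 2: "((\<lambda>x. ?c * ?e x) has_vector_derivative ?c * (?c * ?e x)) (at x)"
      by (intro has_vector_derivative_mult_right fourier_char_has_derivative)
    show ?thesis
      using has_vector_derivative_diff[OF has_vector_derivative_mult[OF 1(2) fourier_char_has_derivative[of m x]]
        has_vector_derivative_mult[OF 1(1) 2]]
      by (simp add: numeral_2_eq_2 algebra_simps)
  qed
  then have "(LINT x|torus. ?g x) = ?f (1/2) - ?f (-1/2)"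
    by (rule integral_torus_FTC) (intro continuous_intros cont fourier_char_continuous)
  also have "\<dots> = 0"
    using half fourier_char_half[of m] by simp
  also have "?g = (\<lambda>x. of_real (laplace_eigenvalue m) * (cnj (u x) * ?e x) - cnj (v x) * ?e x)"
    by (auto simp: v d0 laplace_eigenvalue_def power2_eq_square algebra_simps)
  finally have "(LINT x|torus. of_real (laplace_eigenvalue m) * (cnj (u x) * ?e x) - cnj (v x) * ?e x) = 0" .
  then show "inner2 v ?e = of_real (laplace_eigenvalue m) * inner2 u ?e"
    using integrable_cnj_mult[OF u fourier_char_in_L2] integrable_cnj_mult[OF v2 fourier_char_in_L2]
    by (simp add: inner2_def)
qed

text \<open>Both sides are continuous in \<open>u\<close> and \<open>v\<close>, so the identity for
  smooth functions survives the closure of the graph.\<close>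

lemma laplacian_inner2_fourier_char:
  assumes "(u, v) \<in> laplacian"
  shows "inner2 v (fourier_char m) = of_real (laplace_eigenvalue m) * inner2 u (fourier_char m)"
proof -
  from assms obtain us vs where L2: "u \<in> L2" "v \<in> L2"
    and A: "\<And>n. (us n, vs n) \<in> laplacian_smooth"
    and lim: "(\<lambda>n. norm2 (\<lambda>x. us n x - u x)) \<longlonglongrightarrow> 0" "(\<lambda>n. norm2 (\<lambda>x. vs n x - v x)) \<longlonglongrightarrow> 0"
    by (auto simp: laplacian_def op_closure_def)
  note s = smooth_inner2_fourier_char[OF A]
  have "(\<lambda>n. inner2 (vs n) (fourier_char m)) \<longlonglongrightarrow> inner2 v (fourier_char m)"
    using s L2 lim by (intro tendsto_inner2_left fourier_char_in_L2)
  moreover have "(\<lambda>n. inner2 (us n) (fourier_char m)) \<longlonglongrightarrow> inner2 u (fourier_char m)"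
    using s L2 lim by (intro tendsto_inner2_left fourier_char_in_L2)
  then have "(\<lambda>n. inner2 (vs n) (fourier_char m))
      \<longlonglongrightarrow> of_real (laplace_eigenvalue m) * inner2 u (fourier_char m)"
    unfolding s(3) by (rule tendsto_mult_left)
  ultimately show ?thesis by (rule LIMSEQ_unique)
qed

text \<open>\<open>fun_calc\<close> tests against eigenvectors \<open>w\<close> of the Laplacian
  with eigenvalue \<open>t\<close>. By symmetry, either \<open>t\<close> is the eigenvalue of the
  character, or \<open>w\<close> is orthogonal to it and both sides vanish.\<close>

lemma T_laplacian_fourier_char:
  "(fourier_char m, \<lambda>x. of_real (T_eigenvalue m) * fourier_char m x) \<in> T_laplacian"
proof -
  have "inner2 w (\<lambda>x. of_real (T_eigenvalue m) * fourier_char m x)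
      = of_real ((1 + t) powr (-1/2)) * inner2 w (fourier_char m)"
    if "(w, \<lambda>x. of_real t * w x) \<in> laplacian" for t w
  proof -
    have "of_real t * inner2 w (fourier_char m)
        = of_real (laplace_eigenvalue m) * inner2 w (fourier_char m)"
      using laplacian_inner2_fourier_char[OF that, of m] by (simp add: inner2_scale_left)
    then have "t = laplace_eigenvalue m \<or> inner2 w (fourier_char m) = 0"
      by (metis mult_cancel_right of_real_eq_iff)
    then show ?thesis
      by (auto simp: inner2_scale_right T_eigenvalue_def)
  qed
  then show ?thesis
    by (auto simp: T_laplacian_def fun_calc_def intro: fourier_char_in_L2 L2_scale)
qed

text \<open>The character is an eigenvector of \<open>T_laplacian\<close>, hence one of the test
  vectors in the definition of \<open>fun_calc\<close>.\<close>

lemma T_laplacian_sqrt_fourier_coeff: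
  assumes "(u, w) \<in> T_laplacian_sqrt"
  shows "u \<in> L2" "w \<in> L2"
    "inner2 (fourier_char m) w = of_real (sqrt (T_eigenvalue m)) * inner2 (fourier_char m) u"
  using assms T_laplacian_fourier_char[of m]
  by (auto simp: T_laplacian_sqrt_def fun_calc_def T_eigenvalue_def powr_half_sqrt)

section \<open>Size of the eigenvalues of \<open>T_laplacian\<close> and divergence of their
  sum\<close>

lemma T_eigenvalue_nonneg: "T_eigenvalue m \<ge> 0"
  by (simp add: T_eigenvalue_def)

lemma T_eigenvalue_ge:
  assumes "m > 0"
  shows "T_eigenvalue (int m) \<ge> inverse (9 * real m)"
proof -
  \<comment> \<open>The constant 9 comes from \<pi> < 4: 1 + (8m)^2 \<le> 65 m^2 \<le>
    (9m)^2.\<close>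
  have "(2 * pi * real m)\<^sup>2 \<le> (8 * real m)\<^sup>2"
    using pi_less_4 by (intro power_mono mult_right_mono) auto
  moreover have "1 \<le> (real m)\<^sup>2"
    using assms by simp
  ultimately have "1 + laplace_eigenvalue (int m) \<le> (9 * real m)\<^sup>2"
    by (simp add: laplace_eigenvalue_def power_mult_distrib)
  then have "sqrt (1 + laplace_eigenvalue (int m)) \<le> 9 * real m"
    by (intro real_le_lsqrt) auto
  moreover have pos: "1 + laplace_eigenvalue (int m) > 0"
    unfolding laplace_eigenvalue_def by (intro add_pos_nonneg) auto
  ultimately have "inverse (9 * real m) \<le> inverse (sqrt (1 + laplace_eigenvalue (int m)))"
    by (intro le_imp_inverse_le) auto
  also have "\<dots> = T_eigenvalue (int m)"
    using pos by (simp add: T_eigenvalue_def powr_minus powr_half_sqrt)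
  finally show ?thesis .
qed

text \<open>The eigenvalues are at least 1/(9m), so bounded partial sums would make the harmonic
  series converge.\<close>

lemma sum_T_eigenvalue_unbounded:
  obtains M where "M > 0" "(\<Sum>m = 1..M. T_eigenvalue (int m)) \<ge> B"
proof -
  have "\<exists>M>0. (\<Sum>m = 1..M. T_eigenvalue (int m)) \<ge> B"
  proof (rule ccontr)
    assume "\<not> ?thesis"
    then have less: "(\<Sum>m = 1..M. T_eigenvalue (int m)) < B" if "M > 0" for M
      using that by (meson not_le)
    have "(\<Sum>m<n. T_eigenvalue (int (Suc m))) \<le> B" for n
    proof -
      have "(\<Sum>m<n. T_eigenvalue (int (Suc m))) \<le> (\<Sum>m<Suc n. T_eigenvalue (int (Suc m)))"
        using T_eigenvalue_nonneg by simp
      also have "\<dots> = (\<Sum>m = 1..Suc n. T_eigenvalue (int m))"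
        using sum.atLeast1_atMost_eq[of "\<lambda>m. T_eigenvalue (int m)" "Suc n"] by simp
      finally show ?thesis using less[of "Suc n"] by simp
    qed
    then have "summable (\<lambda>m. T_eigenvalue (int (Suc m)))"
      by (intro summableI_nonneg_bounded[of _ B] T_eigenvalue_nonneg)
    then have "summable (\<lambda>m. 9 * T_eigenvalue (int m))"
      by (intro summable_mult) (subst (asm) summable_Suc_iff)
    then have "summable (\<lambda>m. inverse (real m))"
    proof (rule summable_comparison_test[rotated], intro exI[of _ 1] allI impI)
      fix m :: nat assume "1 \<le> m"
      then show "norm (inverse (real m)) \<le> 9 * T_eigenvalue (int m)"
        using T_eigenvalue_ge[of m] by (simp add: field_simps)
    qed
    then show False using not_summable_harmonic[where 'a = real] by simp
  qed
  then show ?thesis using that by blast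
qed

subsection \<open>Fejer kernels and the density\<close>

definition fejer :: "nat \<Rightarrow> real \<Rightarrow> real" where
  "fejer N x = (norm (\<Sum>k<N. fourier_char (int k) x))\<^sup>2 / real N"

lemma fejer_nonneg: "fejer N x \<ge> 0"
  by (simp add: fejer_def)

text \<open>Expanding the square. Collecting equal differences \<open>j - k\<close> would give the
  usual weights 1 - |l|/N; the double sum is kept, so that later estimates reduce to counting index
  pairs.\<close>

lemma fejer_eq_sum:
  "complex_of_real (fejer N x)
    = (\<Sum>j<N. \<Sum>k<N. of_real (1 / real N) * fourier_char (int j - int k) x)"
proof -
  have "complex_of_real ((norm (\<Sum>k<N. fourier_char (int k) x))\<^sup>2)
      = (\<Sum>j<N. fourier_char (int j) x) * (\<Sum>k<N. cnj (fourier_char (int k) x))"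
    by (simp only: complex_norm_square cnj_sum)
  also have "\<dots> = (\<Sum>j<N. \<Sum>k<N. fourier_char (int j - int k) x)"
    by (simp only: sum_product mult.commute[of "fourier_char _ _" "cnj _"] cnj_fourier_char_mult)
  finally show ?thesis
    by (simp add: fejer_def sum_distrib_left sum_divide_distrib)
qed

lemma fejer_continuous: "continuous_on UNIV (fejer N)"
  unfolding fejer_def [abs_def] divide_inverse by (intro continuous_intros fourier_char_continuous)

lemma fejer_integrable: "integrable torus (fejer N)"
  by (rule continuous_imp_integrable_real[OF continuous_on_subset[OF fejer_continuous]]) simp

lemma fejer_in_L2: "(\<lambda>x. complex_of_real (fejer N x)) \<in> L2"
  by (intro L2_continuous continuous_on_of_real fejer_continuous)

lemma inner2_fejer:
  assumes "w \<in> L2"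
  shows "inner2 (\<lambda>x. of_real (fejer N x)) w
    = (\<Sum>j<N. \<Sum>k<N. of_real (1 / real N) * inner2 (fourier_char (int j - int k)) w)"
  using assms
  by (simp only: fejer_eq_sum inner2_sum_left inner2_scale_left finite_lessThan L2_sum L2_scale
      fourier_char_in_L2 complex_cnj_complex_of_real)

text \<open>Orthonormality leaves the \<open>N\<close> diagonal terms, each 1/N. For
  \<open>N = 0\<close> division by zero makes the kernel vanish.\<close>

lemma integral_fejer:
  assumes "N > 0"
  shows "(LINT x|torus. fejer N x) = 1"
proof -
  have "complex_of_real (LINT x|torus. fejer N x)
      = inner2 (\<lambda>x. of_real (fejer N x)) (fourier_char 0)"
    by (simp add: inner2_def fourier_char_0 integral_complex_of_real)
  also have "\<dots> = (\<Sum>j<N. \<Sum>k<N. if j = k then of_real (1 / real N) else 0)"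
    unfolding inner2_fejer[OF fourier_char_in_L2] inner2_fourier_char
    by (intro sum.cong refl) auto
  also have "\<dots> = complex_of_real 1"
    using assms by simp
  finally show ?thesis by (simp only: of_real_eq_iff)
qed

text \<open>The density is 1 plus the series of the \<open>g j\<close> weighted by 2^(-j). The
  weights make its integral finite, and the summand 1 makes it positive everywhere.\<close>

lemma integrable_dominating_density:
  fixes g :: "nat \<Rightarrow> 'a \<Rightarrow> real"
  assumes "finite_measure M" and int: "\<And>j. integrable M (g j)"
    and nonneg: "\<And>j x. g j x \<ge> 0" and le: "\<And>j. (LINT x|M. g j x) \<le> 1"
  obtains f :: "'a \<Rightarrow> real" where "integrable M f" "\<And>x. f x > 0"
    "\<And>j. AE x in M. (1/2) ^ j * g j x \<le> f x"
proof -
  interpret finite_measure M by fact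
  note [measurable] = borel_measurable_integrable[OF int]
  define G where "G x = (\<Sum>j. ennreal ((1/2) ^ j * g j x))" for x
  have G_meas [measurable]: "G \<in> borel_measurable M"
    unfolding G_def [abs_def] by measurable
  have "(\<integral>\<^sup>+x. G x \<partial>M) = (\<Sum>j. \<integral>\<^sup>+x. ennreal ((1/2) ^ j * g j x) \<partial>M)"
    unfolding G_def by (intro nn_integral_suminf) measurable
  also have "\<dots> \<le> (\<Sum>j. ennreal ((1/2) ^ j))"
  proof (intro suminf_le)
    fix j
    have "(\<integral>\<^sup>+x. ennreal ((1/2) ^ j * g j x) \<partial>M) = ennreal ((1/2) ^ j * (LINT x|M. g j x))"
      using nn_integral_eq_integral[of M "\<lambda>x. (1/2) ^ j * g j x"] int nonneg by simp
    also have "\<dots> \<le> ennreal ((1/2) ^ j)"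
      using le by (intro ennreal_leI) (simp add: mult_left_le)
    finally show "(\<integral>\<^sup>+x. ennreal ((1/2) ^ j * g j x) \<partial>M) \<le> ennreal ((1/2) ^ j)" .
  qed auto
  also have "\<dots> < \<infinity>"
  proof -
    have "summable (\<lambda>j. (1/2 :: real) ^ j)" by (simp add: summable_geometric)
    then show ?thesis by (subst suminf_ennreal2) auto
  qed
  finally have finite: "(\<integral>\<^sup>+x. G x \<partial>M) < \<infinity>" .
  have "integrable M (\<lambda>x. enn2real (G x))"
  proof (rule integrableI_bounded)
    have "ennreal (norm (enn2real y)) \<le> y" for y
      by (cases y) auto
    then have "(\<integral>\<^sup>+x. ennreal (norm (enn2real (G x))) \<partial>M) \<le> (\<integral>\<^sup>+x. G x \<partial>M)"
      by (intro nn_integral_mono) auto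
    with finite show "(\<integral>\<^sup>+x. ennreal (norm (enn2real (G x))) \<partial>M) < \<infinity>"
      by (rule le_less_trans[rotated])
  qed measurable
  then have "integrable M (\<lambda>x. 1 + enn2real (G x))"
    by simp
  moreover have "1 + enn2real (G x) > 0" for x
    using enn2real_nonneg[of "G x"] by linarith
  moreover have "AE x in M. (1/2) ^ j * g j x \<le> 1 + enn2real (G x)" for j
  proof -
    \<comment> \<open>Where \<open>G\<close> is infinite, \<open>enn2real\<close> returns 0 and
      domination may fail; this happens only on a null set.\<close>
    have "AE x in M. G x \<noteq> \<infinity>"
      using finite by (intro nn_integral_PInf_AE) auto
    then show ?thesis
    proof eventually_elim
      case (elim x)
      have "ennreal ((1/2) ^ j * g j x) \<le> G x"
        unfolding G_def using sum_le_suminf[of "\<lambda>j. ennreal ((1/2) ^ j * g j x)" "{j}"] by simp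
      then have "enn2real (ennreal ((1/2) ^ j * g j x)) \<le> enn2real (G x)"
        using elim by (intro enn2real_mono) (auto simp: top.not_eq_extremum)
      then show ?case using nonneg[of j x] by simp
    qed
  qed
  ultimately show ?thesis by (rule that)
qed

subsection \<open>The test functional\<close>

text \<open>The inner product of T^(1/2) F_N with \<open>u\<close>, written out in Fourier
  coefficients so that it is visibly defined and continuous on all of \<open>L2\<close>.\<close>

definition fejer_functional :: "nat \<Rightarrow> (real \<Rightarrow> complex) \<Rightarrow> complex" where
  "fejer_functional N u = (\<Sum>j<N. \<Sum>k<N. of_real (1 / real N) *
     (of_real (sqrt (T_eigenvalue (int j - int k))) * inner2 (fourier_char (int j - int k)) u))"

lemma inner2_fejer_T_laplacian_sqrt:
  assumes "(u, w) \<in> T_laplacian_sqrt"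
  shows "inner2 (\<lambda>x. of_real (fejer N x)) w = fejer_functional N u"
  unfolding inner2_fejer[OF T_laplacian_sqrt_fourier_coeff(2)[OF assms]]
    T_laplacian_sqrt_fourier_coeff(3)[OF assms] fejer_functional_def ..

lemma sandwiched_mult_fejer_bound:
  assumes f: "integrable torus f" "\<And>x. f x > 0" and c: "c > 0" and N: "N > 0"
    and dom: "AE x in torus. c * fejer N x \<le> f x"
    and uv: "(u, v) \<in> sandwiched_mult f"
  shows "u \<in> L2" "v \<in> L2" "(norm (fejer_functional N u))\<^sup>2 \<le> norm (inner2 u v) / c"
proof -
  obtain w y where T: "(u, w) \<in> T_laplacian_sqrt" and M: "(w, y) \<in> mult_op (\<lambda>x. sqrt (f x))"
    and adj: "(y, v) \<in> op_adjoint (T_laplacian_sqrt O mult_op (\<lambda>x. sqrt (f x)))"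
    using uv by (auto simp: sandwiched_mult_def op_abs_sq_def)
  show u: "u \<in> L2" and v: "v \<in> L2"
    using T_laplacian_sqrt_fourier_coeff(1)[OF T] adj by (auto simp: op_adjoint_def)
  have w: "w \<in> L2" and y: "y \<in> L2" and y_eq: "AE x in torus. y x = of_real (sqrt (f x)) * w x"
    using M by (auto simp: mult_op_def)
  \<comment> \<open>The defining relation of the adjoint is tested on the pair \<open>(u, y)\<close>
    itself; in particular \<open>inner2 u v\<close> is real and nonnegative.\<close>
  have "inner2 y y = inner2 u v"
    using adj T M by (fastforce simp: op_adjoint_def)
  then have norm_y: "(norm2 y)\<^sup>2 = norm (inner2 u v)"
    unfolding inner2_self by (metis abs_of_nonneg norm_of_real zero_le_power2)
  let ?g = "\<lambda>x. complex_of_real (fejer N x / sqrt (f x))"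
  note [measurable] = borel_measurable_integrable[OF f(1)] borel_measurable_integrable[OF fejer_integrable]
  \<comment> \<open>Domination of the kernel \<open>F\<close> by \<open>f / c\<close> gives F^2 / f
    \<le> F / c, and \<open>F\<close> has integral 1; hence the bound 1/c for the squared norm of
    \<open>?g\<close>.\<close>
  have g_le: "AE x in torus. (norm (?g x))\<^sup>2 \<le> fejer N x / c"
    using dom
  proof eventually_elim
    case (elim x)
    have "c * fejer N x * fejer N x \<le> f x * fejer N x"
      using elim fejer_nonneg by (intro mult_right_mono)
    then have "(fejer N x)\<^sup>2 / f x \<le> fejer N x / c"
      using f(2)[of x] c by (simp add: field_simps power2_eq_square)
    then show ?case
      using f(2)[of x] by (simp add: norm_divide power_divide)
  qed
  have int_c: "integrable torus (\<lambda>x. fejer N x / c)"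
    using fejer_integrable by simp
  have g_int: "integrable torus (\<lambda>x. (norm (?g x))\<^sup>2)"
  proof (rule Bochner_Integration.integrable_bound[OF int_c])
    show "AE x in torus. norm ((norm (?g x))\<^sup>2) \<le> norm (fejer N x / c)"
      using g_le by eventually_elim (use c fejer_nonneg in simp)
  qed measurable
  have g: "?g \<in> L2"
    unfolding L2_def using g_int by (intro CollectI conjI) measurable
  have "(norm2 ?g)\<^sup>2 \<le> (LINT x|torus. fejer N x / c)"
    unfolding norm2_squared by (rule integral_mono_AE[OF g_int int_c g_le])
  also have "\<dots> = 1 / c"
    using integral_fejer[OF N] by simp
  finally have norm_g: "(norm2 ?g)\<^sup>2 \<le> 1 / c" .
  have "fejer_functional N u = inner2 (\<lambda>x. of_real (fejer N x)) w"
    using inner2_fejer_T_laplacian_sqrt[OF T] by simp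
  also have "\<dots> = inner2 ?g y"
    unfolding inner2_def
  proof (rule integral_cong_AE)
    show "AE x in torus. cnj (of_real (fejer N x)) * w x = cnj (?g x) * y x"
      using y_eq
    proof eventually_elim
      case (elim x)
      have "complex_of_real (sqrt (f x)) \<noteq> 0"
        using f(2)[of x] by simp
      with elim show ?case by simp
    qed
  qed (use integrable_cnj_mult[OF fejer_in_L2 w] integrable_cnj_mult[OF g y]
      borel_measurable_integrable in blast)+
  finally have "(norm (fejer_functional N u))\<^sup>2 \<le> (norm2 ?g * norm2 y)\<^sup>2"
    using inner2_Cauchy_Schwarz[OF g y] by (simp add: power_mono)
  also have "\<dots> \<le> 1 / c * (norm2 y)\<^sup>2"
    using norm_g by (simp only: power_mult_distrib mult_right_mono zero_le_power2)
  finally show "(norm (fejer_functional N u))\<^sup>2 \<le> norm (inner2 u v) / c"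
    by (simp add: norm_y)
qed

text \<open>The functional is a finite combination of Fourier coefficients, so both sides of the
  estimate are continuous along the approximating sequences.\<close>

lemma closure_sandwiched_mult_fejer_bound:
  assumes f: "integrable torus f" "\<And>x. f x > 0" and c: "c > 0" and N: "N > 0"
    and dom: "AE x in torus. c * fejer N x \<le> f x"
    and uv: "(u, v) \<in> op_closure (sandwiched_mult f)"
  shows "(norm (fejer_functional N u))\<^sup>2 \<le> norm (inner2 u v) / c"
proof -
  from uv obtain us vs where L2: "u \<in> L2" "v \<in> L2"
    and A: "\<And>n. (us n, vs n) \<in> sandwiched_mult f"
    and lim: "(\<lambda>n. norm2 (\<lambda>x. us n x - u x)) \<longlonglongrightarrow> 0" "(\<lambda>n. norm2 (\<lambda>x. vs n x - v x)) \<longlonglongrightarrow> 0"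
    by (auto simp: op_closure_def)
  note s = sandwiched_mult_fejer_bound[OF f c N dom A]
  have "(\<lambda>n. fejer_functional N (us n)) \<longlonglongrightarrow> fejer_functional N u"
    unfolding fejer_functional_def
    by (intro tendsto_sum tendsto_mult_left tendsto_inner2_right fourier_char_in_L2 s L2 lim)
  then have "(\<lambda>n. (norm (fejer_functional N (us n)))\<^sup>2) \<longlonglongrightarrow> (norm (fejer_functional N u))\<^sup>2"
    by (intro tendsto_intros)
  moreover have "(\<lambda>n. inner2 (us n) (vs n)) \<longlonglongrightarrow> inner2 u v"
    by (intro tendsto_inner2 s L2 lim)
  then have "(\<lambda>n. norm (inner2 (us n) (vs n)) / c) \<longlonglongrightarrow> norm (inner2 u v) / c"
    using c by (intro tendsto_intros) auto
  ultimately show ?thesis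
    using s(3) by (intro LIMSEQ_le) auto
qed

text \<open>T^(1/2) applied to the sum of the characters of frequency 1 to \<open>M\<close>: in
  \<open>fejer_functional\<close> the two square roots then multiply to full eigenvalues.\<close>

definition test_vector :: "nat \<Rightarrow> real \<Rightarrow> complex" where
  "test_vector M x =
     (\<Sum>m = 1..M. of_real (sqrt (T_eigenvalue (int m))) * fourier_char (int m) x)"

lemma test_vector_in_L2: "test_vector M \<in> L2"
  unfolding test_vector_def [abs_def] by (intro L2_sum L2_scale fourier_char_in_L2) simp

lemma inner2_test_vector:
  "inner2 (fourier_char l) (test_vector M)
    = of_real (\<Sum>m = 1..M. if l = int m then sqrt (T_eigenvalue (int m)) else 0)"
  unfolding test_vector_def [abs_def]
  by (simp add: inner2_sum_right inner2_scale_right inner2_fourier_char L2_scale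
      fourier_char_in_L2 if_distrib cong: if_cong)

lemma inner2_test_vector_nat:
  assumes "m \<in> {1..M}"
  shows "inner2 (fourier_char (int m)) (test_vector M) = of_real (sqrt (T_eigenvalue (int m)))"
  using assms by (simp add: inner2_test_vector)

lemma norm2_test_vector: "(norm2 (test_vector M))\<^sup>2 = (\<Sum>m = 1..M. T_eigenvalue (int m))"
proof -
  have "complex_of_real ((norm2 (test_vector M))\<^sup>2) = inner2 (test_vector M) (test_vector M)"
    by (simp add: inner2_self)
  also have "\<dots> = (\<Sum>m = 1..M. of_real (sqrt (T_eigenvalue (int m))) *
      inner2 (fourier_char (int m)) (test_vector M))"
    by (subst test_vector_def [abs_def])
      (simp add: inner2_sum_left inner2_scale_left L2_scale fourier_char_in_L2 test_vector_in_L2)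
  also have "\<dots> = (\<Sum>m = 1..M. of_real (T_eigenvalue (int m)))"
    by (intro sum.cong refl)
      (simp add: inner2_test_vector_nat T_eigenvalue_nonneg flip: of_real_mult)
  finally show ?thesis
    by (simp only: of_real_sum [symmetric] of_real_eq_iff)
qed

text \<open>Among the differences of indices below 2M each frequency from 1 to \<open>M\<close>
  occurs at least \<open>M\<close> times, so its weight in the kernel is at least M/(2M) =
  1/2.\<close>

lemma fejer_functional_test_vector:
  assumes "M > 0"
  shows "norm (fejer_functional (2 * M) (test_vector M)) \<ge> (\<Sum>m = 1..M. T_eigenvalue (int m)) / 2"
proof -
  \<comment> \<open>The contribution of frequency \<open>l\<close>: it equals the eigenvalue for
    \<open>l\<close> from 1 to \<open>M\<close> and is nonnegative throughout, so enlarging index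
    sets only increases the sum.\<close>
  define h where "h l = sqrt (T_eigenvalue l) *
    (\<Sum>m = 1..M. if l = int m then sqrt (T_eigenvalue (int m)) else 0)" for l
  have h_nonneg: "h l \<ge> 0" for l
    unfolding h_def by (intro mult_nonneg_nonneg sum_nonneg) (auto simp: T_eigenvalue_nonneg)
  have h_nat: "h (int m) = T_eigenvalue (int m)" if "m \<in> {1..M}" for m
    using that by (simp add: h_def T_eigenvalue_nonneg)
  have "real M * (\<Sum>m = 1..M. T_eigenvalue (int m)) = (\<Sum>k<M. \<Sum>m = 1..M. h (int m))"
    by (simp add: h_nat)
  \<comment> \<open>Substituting j = m + k; since k < M and m \<le> M, the index \<open>j\<close>
    stays below 2M.\<close>
  also have "\<dots> = (\<Sum>k<M. \<Sum>j = 1+k..M+k. h (int j - int k))"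
    by (simp only: sum.shift_bounds_cl_nat_ivl) simp
  also have "\<dots> \<le> (\<Sum>k<M. \<Sum>j<2*M. h (int j - int k))"
    by (intro sum_mono sum_mono2 h_nonneg) auto
  also have "\<dots> \<le> (\<Sum>k<2*M. \<Sum>j<2*M. h (int j - int k))"
    by (intro sum_mono2 sum_nonneg h_nonneg) auto
  also have "\<dots> = (\<Sum>j<2*M. \<Sum>k<2*M. h (int j - int k))"
    by (rule sum.swap)
  finally have "(\<Sum>m = 1..M. T_eigenvalue (int m)) / 2
      \<le> (\<Sum>j<2*M. \<Sum>k<2*M. h (int j - int k)) / real (2 * M)"
    using assms by (simp add: field_simps)
  also have "\<dots> = norm (complex_of_real \<dots>)"
    by (simp only: norm_of_real abs_of_nonneg sum_nonneg h_nonneg divide_nonneg_nonneg of_nat_0_le_iff)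
  also have "complex_of_real ((\<Sum>j<2*M. \<Sum>k<2*M. h (int j - int k)) / real (2 * M))
      = fejer_functional (2 * M) (test_vector M)"
    unfolding fejer_functional_def inner2_test_vector h_def
    by (simp add: sum_divide_distrib)
  finally show ?thesis .
qed

section \<open>Choice of the density and contradiction with boundedness of the closure\<close>

theorem lemma5p7:
  "\<exists>f :: real \<Rightarrow> real. integrable torus f \<and> (\<forall>x. f x > 0) \<and>
     \<not> hilbert_schmidt (op_closure (sandwiched_mult f))"
proof -
  define S where "S M = (\<Sum>m = 1..M. T_eigenvalue (int m))" for M
  \<comment> \<open>The growth 4^j beats the factor 2^j lost through the weight (1/2)^j of the
    \<open>j\<close>-th kernel in the density.\<close>
  have "\<exists>M>0. S M \<ge> 4 ^ j" for j
    unfolding S_def using sum_T_eigenvalue_unbounded[of "4 ^ j"] by blast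
  then obtain M where M: "\<And>j. M j > 0" "\<And>j. S (M j) \<ge> 4 ^ j"
    by metis
  have "finite_measure torus"
    by (intro finite_measureI) (simp add: emeasure_restrict_space)
  then obtain f where f: "integrable torus f" "\<And>x. f x > 0"
    and dom: "\<And>j. AE x in torus. (1/2) ^ j * fejer (2 * M j) x \<le> f x"
    by (rule integrable_dominating_density[where g = "\<lambda>j. fejer (2 * M j)"])
      (use fejer_integrable fejer_nonneg integral_fejer M(1) in auto)
  have "\<not> hilbert_schmidt (op_closure (sandwiched_mult f))"
  proof
    let ?K = "op_closure (sandwiched_mult f)"
    assume "hilbert_schmidt ?K"
    then have "bounded_operator ?K" by (simp add: hilbert_schmidt_def)
    then obtain C where Dom: "Domain ?K = L2" and "\<forall>(u, v) \<in> ?K. norm2 v \<le> C * norm2 u"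
      by (auto simp: bounded_operator_def)
    then have C: "norm2 v \<le> C * norm2 u" if "(u, v) \<in> ?K" for u v
      using that by auto
    have "2 ^ j \<le> 4 * C" for j
    proof -
      let ?u = "test_vector (M j)" and ?S = "S (M j)"
      obtain v where uv: "(?u, v) \<in> ?K"
        using Dom test_vector_in_L2 by blast
      then have v: "v \<in> L2" by (simp add: op_closure_def)
      have pos: "?S > 0"
        using M(2)[of j] by (rule less_le_trans[rotated]) simp
      \<comment> \<open>The functional is at least \<open>?S / 2\<close>, while boundedness gives at
        most \<open>C * ?S\<close> for the inner product, since \<open>?S\<close> is the squared
        norm of \<open>?u\<close>. Cancelling one \<open>?S\<close> leaves \<open>?S\<close> at most
        4 C 2^j.\<close>
      have "(?S / 2)\<^sup>2 \<le> (norm (fejer_functional (2 * M j) ?u))\<^sup>2"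
        using fejer_functional_test_vector[OF M(1)] pos unfolding S_def
        by (intro power_mono) auto
      also have "\<dots> \<le> norm (inner2 ?u v) / (1/2) ^ j"
        using M(1) by (intro closure_sandwiched_mult_fejer_bound[OF f _ _ dom uv]) auto
      also have "\<dots> \<le> C * ?S / (1/2) ^ j"
      proof (intro divide_right_mono)
        have "norm (inner2 ?u v) \<le> norm2 ?u * norm2 v"
          by (intro inner2_Cauchy_Schwarz test_vector_in_L2 v)
        also have "\<dots> \<le> norm2 ?u * (C * norm2 ?u)"
          by (intro mult_left_mono C uv norm2_nonneg)
        also have "\<dots> = C * ?S"
          unfolding S_def norm2_test_vector [symmetric] by (simp add: power2_eq_square)
        finally show "norm (inner2 ?u v) \<le> C * ?S" .
      qed simp
      also have "\<dots> = ?S * (C * 2 ^ j)"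
        by (simp add: power_one_over)
      finally have "?S * ?S \<le> ?S * (4 * C * 2 ^ j)"
        by (simp add: power2_eq_square algebra_simps)
      then have "?S \<le> 4 * C * 2 ^ j"
        using pos by simp
      with M(2)[of j] have "(2 ^ j) * (2 ^ j) \<le> 4 * C * 2 ^ j"
        by (simp add: power_mult_distrib [symmetric])
      then show "2 ^ j \<le> 4 * C" by simp
    qed
    moreover obtain j where "4 * C < 2 ^ j"
      using real_arch_pow[of 2 "4 * C"] by auto
    ultimately show False by (meson not_le)
  qed
  with f show ?thesis by blast
qed

end
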